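(* Let $m,n,r,d$ be integers with $m,n\ge 2$, $d\ge 1$ and $0<r<\min\{m,n\}$. Define $$\mathcal{A}^{m\times n}_{d,r} := \left\{ L(\lambda)R(\lambda) : L(\lambda)\in\mathbb{C}[\lambda]^{m\times r},\ R(\lambda)\in\mathbb{C}[\lambda]^{r\times n},\ \deg(L_{*i})+\deg(R_{i*}) = d \text{ for } i=1,\ldots,r\right\},$$ and, for each integer $a=0,1,\ldots,rd$, the subsets $$\mathcal{A}^{m\times n}_{d,r,a} := \left\{ L(\lambda)R(\lambda) : L(\lambda)R(\lambda)\in\mathcal{A}^{m\times n}_{d,r},\ \sum_{i=1}^{r}\deg(R_{i*}) = a\right\}\subseteq \mathbb{C}[\lambda]^{m\times n}_{d,r}.$$ Then (i) $\mathcal{A}^{m\times n}_{d,r} = \bigcup_{0\le a\le rd}\mathcal{A}^{m\times n}_{d,r,a}$; (ii) $\mathbb{C}[\lambda]^{m\times n}_{d,r} = \bigcup_{0\le a\le rd}\overline{\mathcal{A}^{m\times n}_{d,r,a}}$; (iii) for every $P(\lambda)\in\mathbb{C}[\lambda]^{m\times n}_{d,r}$ there exists an integer $a$ with $0\le a\le rd$ such that $P(\lambda)\in\overline{\mathcal{A}^{m\times n}_{d,r,a}}$.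
   Context: $\mathbb{C}[\lambda]^{p\times q}$ denotes the set of $p\times q$ polynomial matrices with complex coefficients. $\mathbb{C}[\lambda]^{m\times n}_{d,r}$ is the set of $m\times n$ complex polynomial matrices of degree at most $d$ and normal rank (rank over the field of rational functions) at most $r$. For a polynomial matrix $X(\lambda)$, $X_{*i}$ denotes its $i$th column and $X_{i*}$ its $i$th row; the degree of a polynomial vector is the maximum degree of its entries, and the degree of the zero polynomial is $-\infty$ (so $\deg(L_{*i})+\deg(R_{i*})=d$ forces $L_{*i}\neq 0$, $R_{i*}\neq 0$). The topology is the one induced by the distance $\mathrm{dist}(P,Q)=\left(\sum_{i=0}^d\|P_i-Q_i\|_F^2\right)^{1/2}$ on polynomial matrices $P(\lambda)=\sum_{i=0}^d\lambda^iP_i$, $Q(\lambda)=\sum_{i=0}^d\lambda^iQ_i$ of degree at most $d$, where $\|\cdot\|_F$ is the Frobenius norm; $\overline{\mathcal{X}}$ denotes the closure of a set $\mathcal{X}$. *)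

theory Defs
  imports "HOL-Analysis.Analysis" "HOL-Computational_Algebra.Polynomial_Factorial"
    "Jordan_Normal_Form.DL_Rank"
begin

definition vdeg :: "complex poly vec \<Rightarrow> ereal" where
  "vdeg v = (if (\<forall>k<dim_vec v. v $ k = 0) then -\<infinity>
             else ereal (real (Max {degree (v $ k) | k. k < dim_vec v})))"

definition normal_rank :: "complex poly mat \<Rightarrow> nat" where
  "normal_rank P = vec_space.rank (dim_row P) (map_mat to_fract P)"

definition polymat_dr :: "nat \<Rightarrow> nat \<Rightarrow> nat \<Rightarrow> nat \<Rightarrow> complex poly mat set" where
  "polymat_dr m n d r = {P. P \<in> carrier_mat m n \<and>
      (\<forall>i<m. \<forall>j<n. degree (P $$ (i,j)) \<le> d) \<and> normal_rank P \<le> r}"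

definition pm_dist :: "nat \<Rightarrow> complex poly mat \<Rightarrow> complex poly mat \<Rightarrow> real" where
  "pm_dist d P Q = sqrt (\<Sum>k\<le>d. \<Sum>i<dim_row P. \<Sum>j<dim_col P.
       (cmod (coeff (P $$ (i,j)) k - coeff (Q $$ (i,j)) k))\<^sup>2)"

definition pm_closure :: "nat \<Rightarrow> nat \<Rightarrow> nat \<Rightarrow> complex poly mat set \<Rightarrow> complex poly mat set" where
  "pm_closure m n d X = {P. P \<in> carrier_mat m n \<and> (\<forall>i<m. \<forall>j<n. degree (P $$ (i,j)) \<le> d) \<and>
      (\<forall>e>0. \<exists>Q\<in>X. pm_dist d P Q < e)}"

definition A_set :: "nat \<Rightarrow> nat \<Rightarrow> nat \<Rightarrow> nat \<Rightarrow> complex poly mat set" where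
  "A_set m n d r = {L * R | L R. L \<in> carrier_mat m r \<and> R \<in> carrier_mat r n \<and>
      (\<forall>i<r. vdeg (col L i) + vdeg (row R i) = ereal (real d))}"

definition A_set_a :: "nat \<Rightarrow> nat \<Rightarrow> nat \<Rightarrow> nat \<Rightarrow> nat \<Rightarrow> complex poly mat set" where
  "A_set_a m n d r a = {L * R | L R. L \<in> carrier_mat m r \<and> R \<in> carrier_mat r n \<and>
      (\<forall>i<r. vdeg (col L i) + vdeg (row R i) = ereal (real d)) \<and>
      (\<Sum>i<r. vdeg (row R i)) = ereal (real a)}"

end

theory Submission
  imports Defs
begin

text \<open>
  Unimodular row operations turn \<open>P\<close> into a matrix \<open>R = U P\<close> whose nonzero rows have linearly
  independent leading coefficient vectors, with \<open>P = L R\<close>. There are at most \<open>r\<close> such rows, and by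
  the predictable degree property \<open>deg L\<^sub>*\<^sub>k + deg R\<^sub>k\<^sub>* \<le> d\<close>. Adding \<open>\<epsilon> \<lambda>\<^sup>e\<close> with \<open>e = d - deg R\<^sub>k\<^sub>*\<close> to
  the deficient columns of \<open>L\<close> makes the degree sums equal to \<open>d\<close> while \<open>R\<close>, and hence \<open>a\<close>, stays
  the same; so \<open>P\<close> is in the closure of a single \<open>A\<^sub>a\<close>.

  Conversely, let \<open>P\<close> be a limit of products \<open>Q\<^sub>\<nu>\<close> of inner dimension \<open>r\<close>, and \<open>R = U P\<close> reduced with
  \<open>s\<close> nonzero rows. A constant \<open>W\<close> with \<open>det (U P W) \<noteq> 0\<close> exists, but \<open>det (U Q\<^sub>\<nu> W) = 0\<close> whenever
  \<open>r < s\<close>; evaluating at a point where \<open>det (U P W)\<close> does not vanish contradicts continuity of the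
  determinant.
\<close>

section \<open>Row reduction\<close>

text \<open>With \<open>c\<close> ranging over indicator functions, the last condition forces \<open>b k\<close> to be the exact
  degree of row \<open>k\<close>, which is nonzero.\<close>

definition lead_indep ::
    "nat set \<Rightarrow> nat \<Rightarrow> (nat \<Rightarrow> nat \<Rightarrow> 'a :: field poly) \<Rightarrow> (nat \<Rightarrow> nat) \<Rightarrow> bool" where
  "lead_indep J n R b \<longleftrightarrow> finite J \<and> (\<forall>k\<in>J. \<forall>j<n. degree (R k j) \<le> b k) \<and>
     (\<forall>c. (\<forall>j<n. (\<Sum>k\<in>J. c k * coeff (R k j) (b k)) = 0) \<longrightarrow> (\<forall>k\<in>J. c k = 0))"

text \<open>Only the summand \<open>i = a\<close> survives: a smaller \<open>i\<close> overshoots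
  the degree of \<open>g\<close>, a larger one that of \<open>f\<close>. Bounds replace exact
  degrees because an entry may have lower degree than its row.\<close>

lemma coeff_mult_degree_bounds:
  fixes f g :: "'a :: comm_semiring_0 poly"
  assumes "degree f \<le> a" "degree g \<le> b"
  shows "coeff (f * g) (a + b) = coeff f a * coeff g b"
proof -
  have "coeff (f * g) (a + b) = (\<Sum>i\<le>a + b. coeff f i * coeff g (a + b - i))"
    by (rule coeff_mult)
  also have "\<dots> = (\<Sum>i\<le>a + b. if i = a then coeff f a * coeff g b else 0)"
  proof (rule sum.cong)
    fix i assume "i \<in> {..a + b}"
    show "coeff f i * coeff g (a + b - i) = (if i = a then coeff f a * coeff g b else 0)"
    proof (cases i a rule: linorder_cases)
      case less
      then have "coeff g (a + b - i) = 0"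
        using assms by (intro coeff_eq_0) linarith
      then show ?thesis using less by simp
    next
      case greater
      then have "coeff f i = 0" using assms by (intro coeff_eq_0) linarith
      then show ?thesis using greater by simp
    qed simp
  qed simp
  finally show ?thesis by simp
qed

text \<open>Here \<open>b k\<close> bounds the number of coefficients, so that \<open>b k = 0\<close> means a zero row, which is
  dropped. If the leading coefficients are dependent, the longest row involved is shortened by
  subtracting monomial multiples of the others.\<close>

lemma row_reduction_aux:
  fixes P L R U :: "nat \<Rightarrow> nat \<Rightarrow> 'a :: field poly"
  assumes "finite J"
    and "\<forall>i<m. \<forall>j<n. P i j = (\<Sum>k\<in>J. L i k * R k j)"
    and "\<forall>k\<in>J. \<forall>j<n. R k j = (\<Sum>i<m. U k i * P i j)"
    and "\<forall>k\<in>J. \<forall>j<n. \<forall>t\<ge>b k. coeff (R k j) t = 0"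
  shows "\<exists>J L R U b. lead_indep J n R b
    \<and> (\<forall>i<m. \<forall>j<n. P i j = (\<Sum>k\<in>J. L i k * R k j))
    \<and> (\<forall>k\<in>J. \<forall>j<n. R k j = (\<Sum>i<m. U k i * P i j))"
  using assms
\<comment> \<open>The extra 1 per row makes the measure drop also when a row with
  \<open>b k = 0\<close> is discarded.\<close>
proof (induction "\<Sum>k\<in>J. b k + 1" arbitrary: J L R U b rule: less_induct)
  case less
  note fin = less.prems(1) and PLR = less.prems(2) and RUP = less.prems(3) and bd = less.prems(4)
  consider (zero) k where "k \<in> J" "b k = 0"
    | (indep) "\<forall>k\<in>J. b k > 0" "lead_indep J n R (\<lambda>k. b k - 1)"
    | (dep) "\<forall>k\<in>J. b k > 0" "\<not> lead_indep J n R (\<lambda>k. b k - 1)"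
    by auto
  then show ?case
  proof cases
    case zero
    have "(\<Sum>k\<in>J - {k}. b k + 1) < (\<Sum>k\<in>J. b k + 1)"
      using zero fin by (simp add: sum.remove)
    moreover have "R k j = 0" if "j < n" for j
      using bd zero that by (intro poly_eqI) auto
    then have "\<forall>i<m. \<forall>j<n. P i j = (\<Sum>k\<in>J - {k}. L i k * R k j)"
      using PLR fin zero by (simp add: sum.remove)
    ultimately show ?thesis
      using less.hyps[of b "J - {k}" L R U] fin RUP bd by blast
  next
    case indep
    then show ?thesis using PLR RUP by blast
  next
    case dep
    have deg: "degree (R k j) \<le> b k - 1" if "k \<in> J" "j < n" for k j
      using that dep(1) bd by (intro degree_le) auto
    obtain c k1 where c: "\<And>j. j < n \<Longrightarrow> (\<Sum>k\<in>J. c k * coeff (R k j) (b k - 1)) = 0"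
      and k1: "k1 \<in> J" "c k1 \<noteq> 0"
      using dep(2) fin deg unfolding lead_indep_def by blast
    \<comment> \<open>Maximality of \<open>b k0\<close> is needed only among rows taking part in the
      relation; for them \<open>b k0 - b k\<close> is a true difference, not a truncated
      one.\<close>
    define B where "B = {k\<in>J. c k \<noteq> 0}"
    have B: "finite B" "B \<noteq> {}" using fin k1 by (auto simp: B_def)
    then obtain k0 where k0: "k0 \<in> B" "\<And>k. k \<in> B \<Longrightarrow> b k \<le> b k0"
      using finite_has_maximal[of "b ` B"] by (metis (no_types, lifting) Max_ge Max_in finite_imageI image_iff image_is_empty)
    have k0J: "k0 \<in> J" "c k0 \<noteq> 0" using k0 by (auto simp: B_def)
    have b0: "b k0 > 0" using dep k0J by auto
    \<comment> \<open>The monomial shifts position \<open>b k - 1\<close> of row \<open>k\<close> to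
      \<open>b k0 - 1\<close>, so the coefficients meeting there form the dependence relation
      divided by \<open>c k0\<close>. Rows outside \<open>B\<close> get
      \<open>q k = 0\<close>.\<close>
    define q where "q k = monom (c k / c k0) (b k0 - b k)" for k
    have q0: "q k0 = 1" using k0J by (simp add: q_def)
    define R' where "R' k j = (if k = k0 then \<Sum>k\<in>J. q k * R k j else R k j)" for k j
    \<comment> \<open>The inverse elementary operation on the columns of \<open>L\<close>, which
      keeps the product equal to \<open>P\<close>.\<close>
    define L' where "L' i k = (if k = k0 then L i k0 else L i k - L i k0 * q k)" for i k
    define U' where "U' k i = (if k = k0 then \<Sum>k\<in>J. q k * U k i else U k i)" for k i
    define b' where "b' = b(k0 := b k0 - 1)"
    have split: "(\<Sum>k\<in>J. f k) = f k0 + (\<Sum>k\<in>J - {k0}. f k)" for f :: "nat \<Rightarrow> 'a poly"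
      using fin k0J by (simp add: sum.remove)
    have "(\<Sum>k\<in>J. b' k + 1) < (\<Sum>k\<in>J. b k + 1)"
      using fin k0J b0 by (intro sum_strict_mono_ex1) (auto simp: b'_def)
    moreover have "\<forall>i<m. \<forall>j<n. P i j = (\<Sum>k\<in>J. L' i k * R' k j)"
    proof (intro allI impI)
      fix i j assume ij: "i < m" "j < n"
      have "(\<Sum>k\<in>J. L' i k * R' k j) = L i k0 * R' k0 j
        + (\<Sum>k\<in>J - {k0}. (L i k - L i k0 * q k) * R k j)"
        unfolding split by (simp add: L'_def R'_def)
      also have "R' k0 j = R k0 j + (\<Sum>k\<in>J - {k0}. q k * R k j)"
        unfolding R'_def split by (simp add: q0)
      also have "L i k0 * \<dots> + (\<Sum>k\<in>J - {k0}. (L i k - L i k0 * q k) * R k j)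
        = L i k0 * R k0 j + (\<Sum>k\<in>J - {k0}. L i k * R k j)"
        by (simp add: algebra_simps sum_subtractf sum_distrib_left)
      also have "\<dots> = P i j" using PLR ij by (simp add: split)
      finally show "P i j = (\<Sum>k\<in>J. L' i k * R' k j)" by simp
    qed
    moreover have "\<forall>k\<in>J. \<forall>j<n. R' k j = (\<Sum>i<m. U' k i * P i j)"
    proof (intro ballI allI impI)
      fix k j assume kj: "k \<in> J" "j < n"
      have "(\<Sum>k\<in>J. q k * R k j) = (\<Sum>k\<in>J. \<Sum>i<m. q k * U k i * P i j)"
        using RUP kj by (intro sum.cong) (auto simp: sum_distrib_left mult.assoc)
      also have "\<dots> = (\<Sum>i<m. (\<Sum>k\<in>J. q k * U k i) * P i j)"
        by (subst sum.swap) (simp add: sum_distrib_right)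
      finally show "R' k j = (\<Sum>i<m. U' k i * P i j)"
        using RUP kj by (auto simp: R'_def U'_def)
    qed
    moreover have "\<forall>k\<in>J. \<forall>j<n. \<forall>t\<ge>b' k. coeff (R' k j) t = 0"
    proof (intro ballI allI impI)
      fix k j t assume kj: "k \<in> J" "j < n" and t: "b' k \<le> t"
      show "coeff (R' k j) t = 0"
      proof (cases "k = k0")
        case False
        then show ?thesis using bd kj t by (simp add: R'_def b'_def)
      next
        case True
        have t0: "b k0 - 1 \<le> t" using t True by (simp add: b'_def)
        have "coeff (q k * R k j) t = (if t = b k0 - 1 then c k * coeff (R k j) (b k - 1) / c k0 else 0)"
          if "k \<in> J" for k
        proof (cases "c k = 0")
          case True
          then show ?thesis by (simp add: q_def)
        next
          case False
          then have le: "b k \<le> b k0" "b k > 0" using k0 that dep by (auto simp: B_def)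
          show ?thesis
          proof (cases "t = b k0 - 1")
            case True
            then show ?thesis using le b0
              by (auto simp: q_def coeff_monom_mult)
          next
            case False
            then have "t \<ge> b k0" using t0 by simp
            then have "t - (b k0 - b k) \<ge> b k" "t \<ge> b k0 - b k" using le by auto
            then show ?thesis using bd that kj False by (simp add: q_def coeff_monom_mult)
          qed
        qed
        then have "coeff (R' k j) t
            = (\<Sum>k\<in>J. if t = b k0 - 1 then c k * coeff (R k j) (b k - 1) / c k0 else 0)"
          using True by (simp add: R'_def coeff_sum)
        also have "\<dots> = 0"
          using c[OF kj(2)] by (cases "t = b k0 - 1") (simp_all flip: sum_divide_distrib)
        finally show ?thesis .
      qed
    qed
    ultimately show ?thesis using less.hyps[of b' J L' R' U'] fin by blast
  qed
qed

lemma lead_indep_reindex: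
  assumes "lead_indep J n R b" "bij_betw h I J"
  shows "lead_indep I n (\<lambda>k. R (h k)) (\<lambda>k. b (h k))"
  unfolding lead_indep_def
proof (intro conjI allI impI ballI)
  show "finite I" using assms by (auto simp: lead_indep_def bij_betw_finite)
  show "degree (R (h k) j) \<le> b (h k)" if "k \<in> I" "j < n" for k j
    using assms that by (auto simp: lead_indep_def bij_betw_def)
  fix c k
  assume c: "\<forall>j<n. (\<Sum>k\<in>I. c k * coeff (R (h k) j) (b (h k))) = 0" and k: "k \<in> I"
  define c' where "c' = (\<lambda>l. c (the_inv_into I h l))"
  have c': "c' (h k) = c k" if "k \<in> I" for k
    using assms(2) that by (simp add: c'_def bij_betw_def the_inv_into_f_f)
  have "(\<Sum>l\<in>J. c' l * coeff (R l j) (b l)) = 0" if "j < n" for j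
    using c that by (subst sum.reindex_bij_betw[OF assms(2), symmetric]) (simp add: c')
  then have "c' (h k) = 0"
    using assms k unfolding lead_indep_def bij_betw_def by blast
  then show "c k = 0" using c' k by simp
qed

text \<open>The reduction starts from the trivial factorization with identity matrices for
  \<open>L\<close> and \<open>U\<close>, and the surviving rows are renumbered. \<open>L\<close>
  will bound the normal rank of \<open>P\<close> from above by \<open>s\<close>, and
  \<open>U\<close> from below.\<close>

lemma row_reduction:
  fixes P :: "nat \<Rightarrow> nat \<Rightarrow> 'a :: field poly"
  obtains s L R U b where "lead_indep {..<s} n R b"
    "\<And>i j. i < m \<Longrightarrow> j < n \<Longrightarrow> P i j = (\<Sum>k<s. L i k * R k j)"
    "\<And>k j. k < s \<Longrightarrow> j < n \<Longrightarrow> R k j = (\<Sum>i<m. U k i * P i j)"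
proof -
  define b where "b k = Suc (\<Sum>j<n. degree (P k j))" for k
  have if_mult: "(if Q then 1 else 0) * x = (if Q then x else 0)" for Q and x :: "'a poly"
    by simp
  have "\<exists>J L R U b. lead_indep J n R b
    \<and> (\<forall>i<m. \<forall>j<n. P i j = (\<Sum>k\<in>J. L i k * R k j))
    \<and> (\<forall>k\<in>J. \<forall>j<n. R k j = (\<Sum>i<m. U k i * P i j))"
  proof (rule row_reduction_aux)
    show "\<forall>i<m. \<forall>j<n. P i j = (\<Sum>k\<in>{..<m}. (if i = k then 1 else 0) * P k j)"
      "\<forall>k\<in>{..<m}. \<forall>j<n. P k j = (\<Sum>i<m. (if k = i then 1 else 0) * P i j)"
      by (simp_all add: if_mult)
    show "\<forall>k\<in>{..<m}. \<forall>j<n. \<forall>t\<ge>b k. coeff (P k j) t = 0"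
    proof (intro ballI allI impI)
      fix k j t assume "j < n" "b k \<le> t"
      then have "degree (P k j) < t"
        using member_le_sum[of j "{..<n}" "\<lambda>j. degree (P k j)"] by (simp add: b_def)
      then show "coeff (P k j) t = 0" by (rule coeff_eq_0)
    qed
  qed simp
  then obtain J L R U b where li: "lead_indep J n R b"
    and PLR: "\<And>i j. i < m \<Longrightarrow> j < n \<Longrightarrow> P i j = (\<Sum>k\<in>J. L i k * R k j)"
    and RUP: "\<And>k j. k \<in> J \<Longrightarrow> j < n \<Longrightarrow> R k j = (\<Sum>i<m. U k i * P i j)"
    by blast
  have "finite J" using li by (simp add: lead_indep_def)
  then obtain h where h: "bij_betw h {..<card J} J"
    using ex_bij_betw_nat_finite[of J] by (auto simp: atLeast0LessThan)
  show thesis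
  proof (rule that[of "card J" "\<lambda>k. R (h k)" "\<lambda>k. b (h k)" "\<lambda>i k. L i (h k)" "\<lambda>k. U (h k)"])
    show "lead_indep {..<card J} n (\<lambda>k. R (h k)) (\<lambda>k. b (h k))"
      by (rule lead_indep_reindex[OF li h])
    show "P i j = (\<Sum>k<card J. L i (h k) * R (h k) j)" if "i < m" "j < n" for i j
      unfolding PLR[OF that] by (rule sum.reindex_bij_betw[OF h, symmetric])
    show "R (h k) j = (\<Sum>i<m. U (h k) i * P i j)" if "k < card J" "j < n" for k j
      using h that by (intro RUP) (auto simp: bij_betw_def)
  qed
qed

text \<open>At the largest value \<open>D\<close> of \<open>degree (f k) + b k\<close> the
  coefficient vector is a nontrivial combination of the leading vectors, so it cannot cancel. A
  threshold \<open>T\<close> instead of a degree lets \<open>T = 0\<close> express that the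
  combination vanishes.\<close>

lemma predictable_degree:
  assumes R: "lead_indep J n R b"
    and zero: "\<And>j t. j < n \<Longrightarrow> T \<le> t \<Longrightarrow> coeff (\<Sum>k\<in>J. f k * R k j) t = 0"
    and k: "k \<in> J" "f k \<noteq> 0"
  shows "degree (f k) + b k < T"
proof -
  define K where "K = {k\<in>J. f k \<noteq> 0}"
  define D where "D = Max ((\<lambda>k. degree (f k) + b k) ` K)"
  have fin: "finite J" and degR: "\<And>k j. k \<in> J \<Longrightarrow> j < n \<Longrightarrow> degree (R k j) \<le> b k"
    using R by (auto simp: lead_indep_def)
  have K: "finite K" "k \<in> K" using fin k by (auto simp: K_def)
  have D: "degree (f k) + b k \<le> D" if "k \<in> K" for k
    unfolding D_def using K that by (intro Max_ge) auto
  have "D \<in> (\<lambda>k. degree (f k) + b k) ` K" unfolding D_def using K by (intro Max_in) auto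
  then obtain k1 where k1: "k1 \<in> J" "f k1 \<noteq> 0" "D = degree (f k1) + b k1"
    by (auto simp: K_def)
  \<comment> \<open>This is the leading coefficient of \<open>f k\<close> if term \<open>k\<close>
    attains \<open>D\<close>, and 0 otherwise.\<close>
  define c where "c k = coeff (f k) (D - b k)" for k
  have "c k1 \<noteq> 0" using k1 by (simp add: c_def)
  then obtain j where j: "j < n" "(\<Sum>k\<in>J. c k * coeff (R k j) (b k)) \<noteq> 0"
    using R k1 unfolding lead_indep_def by blast
  have "coeff (f k * R k j) D = c k * coeff (R k j) (b k)" if "k \<in> J" for k
  proof (cases "f k = 0")
    case False
    then have "degree (f k) + b k \<le> D" using D that by (simp add: K_def)
    then show ?thesis
      using coeff_mult_degree_bounds[of "f k" "D - b k" "R k j" "b k"] degR that j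
      by (simp add: c_def)
  qed (simp add: c_def)
  then have "coeff (\<Sum>k\<in>J. f k * R k j) D \<noteq> 0" using j by (simp add: coeff_sum)
  then have "D < T" using zero j not_le by blast
  then show ?thesis using D[OF K(2)] by simp
qed

lemma lead_indep_independent:
  assumes "lead_indep J n R b" "\<And>j. j < n \<Longrightarrow> (\<Sum>k\<in>J. f k * R k j) = 0" "k \<in> J"
  shows "f k = 0"
  using predictable_degree[OF assms(1), of 0 f k] assms by auto

section \<open>Rank and inner dimension\<close>

text \<open>Gaussian elimination, one equation per induction step. Cross-multiplication replaces
  division, so an integral domain suffices.\<close>

lemma homogeneous_system_solution:
  fixes a :: "'e \<Rightarrow> 'u \<Rightarrow> 'a :: idom"
  assumes "finite S" "finite J" "card S < card J"
  obtains c where "\<exists>k\<in>J. c k \<noteq> 0" "\<And>v. v \<in> S \<Longrightarrow> (\<Sum>k\<in>J. a v k * c k) = 0"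
proof -
  have "\<exists>c. (\<exists>k\<in>J. c k \<noteq> 0) \<and> (\<forall>v\<in>S. (\<Sum>k\<in>J. a v k * c k) = 0)"
    using assms
  proof (induction S arbitrary: J a rule: finite_induct)
    case empty
    then show ?case by (intro exI[of _ "\<lambda>_. 1"]) (auto simp: card_gt_0_iff)
  next
    case (insert v S)
    show ?case
    proof (cases "\<forall>k\<in>J. a v k = 0")
      case True
      then show ?thesis using insert.IH[of J a] insert by auto
    next
      case False
      then obtain k0 where k0: "k0 \<in> J" "a v k0 \<noteq> 0" by auto
      \<comment> \<open>Unknown \<open>k0\<close> is eliminated from equation \<open>w\<close> with
        pivot \<open>a v k0\<close>.\<close>
      define a' where "a' w k = a w k * a v k0 - a w k0 * a v k" for w k
      have "card S < card (J - {k0})" using insert k0 by simp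
      then obtain c where c: "\<exists>k\<in>J - {k0}. c k \<noteq> 0"
        "\<And>w. w \<in> S \<Longrightarrow> (\<Sum>k\<in>J - {k0}. a' w k * c k) = 0"
        using insert.IH[of "J - {k0}" a'] insert.prems by auto
      \<comment> \<open>Scaling the reduced solution by the pivot lets equation \<open>v\<close> be
        solved for unknown \<open>k0\<close> without division.\<close>
      define c' where "c' k = (if k = k0 then - (\<Sum>k\<in>J - {k0}. a v k * c k) else a v k0 * c k)" for k
      have eq: "(\<Sum>k\<in>J. a w k * c' k) = (\<Sum>k\<in>J - {k0}. a' w k * c k)" for w
      proof -
        have "(\<Sum>k\<in>J. a w k * c' k) = a w k0 * c' k0 + (\<Sum>k\<in>J - {k0}. a w k * c' k)"
          using insert.prems k0 by (simp add: sum.remove)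
        also have "(\<Sum>k\<in>J - {k0}. a w k * c' k) = (\<Sum>k\<in>J - {k0}. a w k * (a v k0 * c k))"
          by (intro sum.cong) (auto simp: c'_def)
        also have "a w k0 * c' k0 + \<dots> = (\<Sum>k\<in>J - {k0}. a' w k * c k)"
          by (simp add: c'_def a'_def algebra_simps sum_subtractf sum_distrib_left)
        finally show ?thesis .
      qed
      have "(\<Sum>k\<in>J. a v k * c' k) = 0" unfolding eq by (simp add: a'_def mult.commute)
      moreover have "\<exists>k\<in>J. c' k \<noteq> 0" using c(1) k0 by (auto simp: c'_def)
      ultimately show ?thesis using c(2) eq by (intro exI[of _ c']) auto
    qed
  qed
  then show thesis using that by blast
qed


context vec_space
begin

text \<open>A maximal independent set \<open>S\<close> of columns spans all columns;
  \<open>g v j\<close> is the coordinate of column \<open>j\<close> along \<open>v\<close>.\<close>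

lemma rank_factorization:
  assumes A: "A \<in> carrier_mat n nc"
  obtains S g where "finite S" "card S = rank A"
    "\<And>i j. i < n \<Longrightarrow> j < nc \<Longrightarrow> A $$ (i, j) = (\<Sum>v\<in>S. v $ i * g v j)"
proof -
  obtain S where S: "finite S" "maximal S (\<lambda>T. T \<subseteq> set (cols A) \<and> lin_indpt T)"
    using maximal_exists_superset[of "set (cols A)" "\<lambda>T. T \<subseteq> set (cols A) \<and> lin_indpt T" "{}"]
    by (auto simp: lin_dep_def)
  have card: "card S = rank A" using rank_card_indpt[OF A S(2)] by simp
  have carr: "set (cols A) \<subseteq> carrier_vec n" using A cols_dim by blast
  have Sub: "S \<subseteq> set (cols A)" "lin_indpt S" and
    max: "\<And>T. S \<subseteq> T \<Longrightarrow> T \<subseteq> set (cols A) \<Longrightarrow> lin_indpt T \<Longrightarrow> T = S"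
    using S(2) unfolding maximal_def by auto
  have "\<exists>a. lincomb a S = col A j" if "j < nc" for j
  proof -
    have cj: "col A j \<in> set (cols A)" using that A by (auto simp: cols_def)
    have "col A j \<in> span S"
    proof (cases "col A j \<in> S")
      case True
      then show ?thesis using Sub carr span_mem[of S] by auto
    next
      case False
      then show ?thesis
        using lin_dep_iff_in_span[of S "col A j"] Sub carr cj max[of "S \<union> {col A j}"] by auto
    qed
    then show ?thesis using finite_in_span[OF S(1), of "col A j"] Sub carr by auto
  qed
  then obtain a where a: "\<And>j. j < nc \<Longrightarrow> lincomb (a j) S = col A j" by metis
  show thesis
  proof (rule that[of S "\<lambda>v j. a j v"])
    fix i j assume ij: "i < n" "j < nc"
    have "A $$ (i, j) = lincomb (a j) S $ i" using a ij A by simp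
    also have "\<dots> = (\<Sum>v\<in>S. a j v * v $ i)"
      using ij Sub carr by (intro lincomb_index) auto
    finally show "A $$ (i, j) = (\<Sum>v\<in>S. v $ i * a j v)" by (simp add: mult.commute)
  qed (use S card in auto)
qed

text \<open>If more than \<open>card J\<close> columns were independent, a nontrivial combination of
  the matching columns of the right factor would vanish, and hence the same combination of columns
  of \<open>A\<close>.\<close>

lemma rank_le_inner_dim:
  assumes A: "A \<in> carrier_mat n nc"
    and fac: "\<And>i j. i < n \<Longrightarrow> j < nc \<Longrightarrow> A $$ (i, j) = (\<Sum>k\<in>J. B i k * C k j)"
    and J: "finite J"
  shows "rank A \<le> card J"
proof (rule ccontr)
  assume gt: "\<not> rank A \<le> card J"
  obtain S where S: "finite S" "maximal S (\<lambda>T. T \<subseteq> set (cols A) \<and> lin_indpt T)"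
    using maximal_exists_superset[of "set (cols A)" "\<lambda>T. T \<subseteq> set (cols A) \<and> lin_indpt T" "{}"]
    by (auto simp: lin_dep_def)
  have card: "card S = rank A" using rank_card_indpt[OF A S(2)] by simp
  have carr: "set (cols A) \<subseteq> carrier_vec n" using A cols_dim by blast
  have Sub: "S \<subseteq> set (cols A)" "lin_indpt S"
    using S(2) unfolding maximal_def by auto
  have "\<exists>j<nc. v = col A j" if "v \<in> S" for v
    using that Sub A by (fastforce simp: cols_def)
  then obtain idx where idx: "\<And>v. v \<in> S \<Longrightarrow> idx v < nc \<and> v = col A (idx v)" by metis
  obtain c where c: "\<exists>v\<in>S. c v \<noteq> 0" "\<And>k. k \<in> J \<Longrightarrow> (\<Sum>v\<in>S. C k (idx v) * c v) = 0"
    using homogeneous_system_solution[of J S "\<lambda>k v. C k (idx v)"] J S gt card by auto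
  have "lincomb c S = 0\<^sub>v n"
  proof (rule eq_vecI)
    show "dim_vec (lincomb c S) = dim_vec (0\<^sub>v n)" using lincomb_dim[OF S(1)] Sub carr by auto
    fix i assume "i < dim_vec (0\<^sub>v n)"
    then have i: "i < n" by simp
    have "lincomb c S $ i = (\<Sum>v\<in>S. c v * v $ i)"
      using i Sub carr by (intro lincomb_index) auto
    also have "\<dots> = (\<Sum>v\<in>S. c v * (\<Sum>k\<in>J. B i k * C k (idx v)))"
    proof (intro sum.cong refl)
      fix v assume "v \<in> S"
      then have "v $ i = A $$ (i, idx v)" using idx[of v] i A by (metis index_col carrier_matD)
      then show "c v * v $ i = c v * (\<Sum>k\<in>J. B i k * C k (idx v))"
        using fac i idx \<open>v \<in> S\<close> by simp
    qed
    also have "\<dots> = (\<Sum>k\<in>J. B i k * (\<Sum>v\<in>S. C k (idx v) * c v))"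
      unfolding sum_distrib_left by (subst sum.swap) (simp add: mult_ac)
    also have "\<dots> = 0" using c by simp
    finally show "lincomb c S $ i = 0\<^sub>v n $ i" using i by simp
  qed
  then have "lin_dep S" using c(1) S(1) by (auto intro!: lin_dep_crit[where A = S and S = S and a = c])
  then show False using Sub by simp
qed

end

text \<open>Turns a relation over the rational functions into one with polynomial coefficients, to
  which \<open>lead_indep_independent\<close> applies.\<close>

lemma common_denominator:
  fixes c :: "'b \<Rightarrow> 'a :: idom fract"
  assumes "finite J"
  obtains D f where "D \<noteq> 0" "\<And>k. k \<in> J \<Longrightarrow> to_fract (f k) = to_fract D * c k"
proof -
  have "\<exists>D f. D \<noteq> 0 \<and> (\<forall>k\<in>J. to_fract (f k) = to_fract D * c k)"
    using assms
  proof (induction J)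
    case empty
    show ?case by (intro exI[of _ 1]) auto
  next
    case (insert l J)
    then obtain D f where Df: "D \<noteq> 0" "\<forall>k\<in>J. to_fract (f k) = to_fract D * c k" by blast
    obtain a d where ad: "c l = Fract a d" "d \<noteq> 0" by (cases "c l") auto
    then have "to_fract d * c l = to_fract a" by (simp add: Fract_conv_to_fract)
    then show ?case using Df ad insert.hyps
      by (intro exI[of _ "D * d"] exI[of _ "\<lambda>k. if k = l then D * a else f k * d"]) auto
  qed
  then show thesis using that by blast
qed

lemma sum_mult_swap:
  fixes w :: "'b \<Rightarrow> 'c \<Rightarrow> 'a :: comm_semiring_0"
  shows "(\<Sum>k\<in>K. c k * (\<Sum>v\<in>S. w k v * g v)) = (\<Sum>v\<in>S. (\<Sum>k\<in>K. w k v * c k) * g v)"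
  unfolding sum_distrib_left sum_distrib_right by (subst sum.swap) (simp add: mult_ac)

text \<open>\<open>P\<close> factors through as many dimensions as its rank, hence so does
  \<open>U P\<close>. With more rows than that, the rows of \<open>R\<close> would be dependent over
  the rational functions, and after clearing denominators over the polynomials.\<close>

lemma lead_indep_le_normal_rank:
  fixes P :: "complex poly mat"
  assumes P: "P \<in> carrier_mat m n"
    and R: "lead_indep {..<s} n R b"
    and RUP: "\<And>k j. k < s \<Longrightarrow> j < n \<Longrightarrow> R k j = (\<Sum>i<m. U k i * P $$ (i, j))"
  shows "s \<le> normal_rank P"
proof (rule ccontr)
  assume gt: "\<not> s \<le> normal_rank P"
  interpret vec_space "TYPE(complex poly fract)" m .
  let ?A = "map_mat to_fract P"
  have A: "?A \<in> carrier_mat m n" using P by simp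
  have rk: "rank ?A = normal_rank P" using P by (simp add: normal_rank_def)
  obtain S g where S: "finite S" "card S = rank ?A"
    and fac: "\<And>i j. i < m \<Longrightarrow> j < n \<Longrightarrow> ?A $$ (i, j) = (\<Sum>v\<in>S. v $ i * g v j)"
    using rank_factorization[OF A] by blast
  \<comment> \<open>A nonzero row vector annihilating \<open>U\<close> times the matrix whose
    columns are the elements of \<open>S\<close>.\<close>
  obtain c where c: "\<exists>k\<in>{..<s}. c k \<noteq> 0"
    "\<And>v. v \<in> S \<Longrightarrow> (\<Sum>k<s. (\<Sum>i<m. to_fract (U k i) * v $ i) * c k) = 0"
    using homogeneous_system_solution[of S "{..<s}" "\<lambda>v k. \<Sum>i<m. to_fract (U k i) * v $ i"]
      S gt rk by auto
  obtain D f where D: "D \<noteq> 0" and f: "\<And>k. k < s \<Longrightarrow> to_fract (f k) = to_fract D * c k"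
    using common_denominator[of "{..<s}" c] by auto
  have "(\<Sum>k<s. f k * R k j) = 0" if j: "j < n" for j
  proof -
    have "to_fract (\<Sum>k<s. f k * R k j) = (\<Sum>k<s. to_fract D * c k * to_fract (R k j))"
      by (simp add: f)
    also have "\<dots> = to_fract D * (\<Sum>k<s. c k * (\<Sum>v\<in>S. (\<Sum>i<m. to_fract (U k i) * v $ i) * g v j))"
      unfolding sum_distrib_left
    proof (intro sum.cong refl, goal_cases)
      case (1 k)
      have "to_fract (R k j) = (\<Sum>i<m. to_fract (U k i) * ?A $$ (i, j))"
        using 1 j P by (simp add: RUP)
      also have "\<dots> = (\<Sum>i<m. \<Sum>v\<in>S. to_fract (U k i) * v $ i * g v j)"
        using fac j by (simp add: sum_distrib_left mult.assoc)
      also have "\<dots> = (\<Sum>v\<in>S. (\<Sum>i<m. to_fract (U k i) * v $ i) * g v j)"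
        by (subst sum.swap) (simp add: sum_distrib_right)
      finally show ?case by (simp add: sum_distrib_left mult.assoc)
    qed
    also have "(\<Sum>k<s. c k * (\<Sum>v\<in>S. (\<Sum>i<m. to_fract (U k i) * v $ i) * g v j))
      = (\<Sum>v\<in>S. (\<Sum>k<s. (\<Sum>i<m. to_fract (U k i) * v $ i) * c k) * g v j)"
      by (rule sum_mult_swap)
    also have "\<dots> = 0" using c by simp
    finally show ?thesis by (simp only: mult_zero_right to_fract_eq_0_iff)
  qed
  then have "f k = 0" if "k < s" for k
    using lead_indep_independent[OF R, of f k] that by simp
  then show False using c(1) f D by (metis lessThan_iff mult_eq_0_iff to_fract_0 to_fract_eq_0_iff)
qed

lemma normal_rank_le_inner_dim:
  fixes P :: "complex poly mat"
  assumes P: "P \<in> carrier_mat m n"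
    and fac: "\<And>i j. i < m \<Longrightarrow> j < n \<Longrightarrow> P $$ (i, j) = (\<Sum>k<s. L i k * R k j)"
  shows "normal_rank P \<le> s"
proof -
  interpret vec_space "TYPE(complex poly fract)" m .
  have "rank (map_mat to_fract P) \<le> card {..<s}"
    using P by (intro rank_le_inner_dim[where nc = n and B = "\<lambda>i k. to_fract (L i k)"
          and C = "\<lambda>k j. to_fract (R k j)"]) (auto simp: fac)
  then show ?thesis using P by (simp add: normal_rank_def)
qed


section \<open>Limits of products of bounded inner dimension\<close>

lemma det_eq_0_iff_row_relation:
  fixes f :: "nat \<Rightarrow> nat \<Rightarrow> 'a :: idom"
  shows "det (mat s s (\<lambda>(k, l). f k l)) = 0 \<longleftrightarrow>
    (\<exists>c. (\<exists>k<s. c k \<noteq> 0) \<and> (\<forall>l<s. (\<Sum>k<s. c k * f k l) = 0))" (is "det ?M = 0 \<longleftrightarrow> ?rhs")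
proof -
  have M: "?M \<in> carrier_mat s s" by simp
  have entry: "(transpose_mat ?M *\<^sub>v v) $ l = (\<Sum>k<s. v $ k * f k l)"
    if "v \<in> carrier_vec s" "l < s" for v l
    using that by (auto simp: scalar_prod_def mult.commute atLeast0LessThan intro!: sum.cong)
  have "det ?M = 0 \<longleftrightarrow> (\<exists>v. v \<in> carrier_vec s \<and> v \<noteq> 0\<^sub>v s \<and> transpose_mat ?M *\<^sub>v v = 0\<^sub>v s)"
    using det_0_iff_vec_prod_zero[of "transpose_mat ?M" s] det_transpose[OF M] by simp
  also have "\<dots> \<longleftrightarrow> ?rhs"
  proof
    assume "\<exists>v. v \<in> carrier_vec s \<and> v \<noteq> 0\<^sub>v s \<and> transpose_mat ?M *\<^sub>v v = 0\<^sub>v s"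
    then obtain v where v: "v \<in> carrier_vec s" "v \<noteq> 0\<^sub>v s" "transpose_mat ?M *\<^sub>v v = 0\<^sub>v s" by blast
    have "\<exists>k<s. v $ k \<noteq> 0" using v(1,2) by (metis carrier_vecD eq_vecI index_zero_vec)
    moreover have "(\<Sum>k<s. v $ k * f k l) = 0" if "l < s" for l
      using entry[OF v(1) that] v(3) that by simp
    ultimately show ?rhs by blast
  next
    assume ?rhs
    then obtain c k where c: "k < s" "c k \<noteq> 0" "\<And>l. l < s \<Longrightarrow> (\<Sum>k<s. c k * f k l) = 0" by blast
    have "vec s c \<noteq> 0\<^sub>v s" using c(1,2) by (metis index_vec index_zero_vec(1))
    moreover have "transpose_mat ?M *\<^sub>v vec s c = 0\<^sub>v s"
    proof (rule eq_vecI)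
      fix l assume "l < dim_vec (0\<^sub>v s :: 'a vec)"
      then have l: "l < s" by simp
      then have "(transpose_mat ?M *\<^sub>v vec s c) $ l = (\<Sum>k<s. vec s c $ k * f k l)"
        by (intro entry) auto
      also have "\<dots> = 0" using c(3)[OF l] by simp
      finally show "(transpose_mat ?M *\<^sub>v vec s c) $ l = 0\<^sub>v s $ l" using l by simp
    qed simp
    ultimately show "\<exists>v. v \<in> carrier_vec s \<and> v \<noteq> 0\<^sub>v s \<and> transpose_mat ?M *\<^sub>v v = 0\<^sub>v s"
      by (intro exI[of _ "vec s c"]) simp
  qed
  finally show ?thesis .
qed

text \<open>A nonzero row vector annihilating the \<open>s\<close> by \<open>r\<close> left factor
  annihilates the product.\<close>

lemma det_eq_0_of_inner_dim:
  fixes B C :: "nat \<Rightarrow> nat \<Rightarrow> 'a :: idom"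
  assumes "r < s"
  shows "det (mat s s (\<lambda>(k, l). \<Sum>t<r. B k t * C t l)) = 0"
proof -
  obtain c where c: "\<exists>k\<in>{..<s}. c k \<noteq> 0" "\<And>t. t \<in> {..<r} \<Longrightarrow> (\<Sum>k<s. B k t * c k) = 0"
    using homogeneous_system_solution[of "{..<r}" "{..<s}" "\<lambda>t k. B k t"] assms by auto
  then have "(\<Sum>k<s. c k * (\<Sum>t<r. B k t * C t l)) = 0" for l
    by (simp add: sum_mult_swap)
  then show ?thesis unfolding det_eq_0_iff_row_relation using c(1) by auto
qed

text \<open>The Leibniz formula shows the determinant as a polynomial in the entries, so it commutes
  with evaluation and with limits.\<close>

lemma det_mat_permutes:
  "det (mat s s (\<lambda>(k, l). f k l)) = (\<Sum>p | p permutes {0..<s}. signof p * (\<Prod>i = 0..<s. f i (p i)))"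
proof -
  have "p i < s" if "p permutes {0..<s}" "i < s" for p i
    using permutes_in_image[OF that(1), of i] that(2) by simp
  then show ?thesis by (auto simp: det_def intro!: sum.cong prod.cong arg_cong2[where f = "(*)"])
qed

lemma poly_det:
  "poly (det (mat s s (\<lambda>(k, l). f k l))) z = det (mat s s (\<lambda>(k, l). poly (f k l) z))"
proof -
  have "poly (signof p) z = signof p" for p by (simp add: sign_def)
  then show ?thesis by (simp add: det_mat_permutes poly_sum poly_prod)
qed

lemma tendsto_det:
  fixes f :: "'b \<Rightarrow> nat \<Rightarrow> nat \<Rightarrow> 'a :: {real_normed_field}"
  assumes "\<And>k l. k < s \<Longrightarrow> l < s \<Longrightarrow> ((\<lambda>x. f x k l) \<longlongrightarrow> g k l) F"
  shows "((\<lambda>x. det (mat s s (\<lambda>(k, l). f x k l))) \<longlongrightarrow> det (mat s s (\<lambda>(k, l). g k l))) F"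
proof -
  have p: "p i < s" if "p permutes {0..<s}" "i < s" for p i
    using permutes_in_image[OF that(1), of i] that(2) by simp
  have "((\<lambda>x. \<Sum>p | p permutes {0..<s}. signof p * (\<Prod>i = 0..<s. f x i (p i)))
    \<longlongrightarrow> (\<Sum>p | p permutes {0..<s}. signof p * (\<Prod>i = 0..<s. g i (p i)))) F"
    by (intro tendsto_sum tendsto_mult tendsto_const tendsto_prod assms) (auto dest: p)
  then show ?thesis by (simp add: det_mat_permutes)
qed

text \<open>For \<open>W\<close> the adjoint of the leading coefficient matrix of \<open>R\<close>, the leading coefficient
  matrix of \<open>R W\<close> is a Gram matrix of independent vectors, so \<open>R W\<close> is again row-reduced.\<close>

lemma lead_indep_complement:
  fixes R :: "nat \<Rightarrow> nat \<Rightarrow> complex poly"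
  assumes R: "lead_indep {..<s} n R b"
  obtains W where "det (mat s s (\<lambda>(k, l). \<Sum>j<n. R k j * [:W j l:])) \<noteq> 0"
proof -
  define a where "a k j = coeff (R k j) (b k)" for k j
  define W where "W j l = cnj (a l j)" for j l
  define R' where "R' k l = (\<Sum>j<n. R k j * [:W j l:])" for k l
  have coeff: "coeff (R' k l) (b k) = (\<Sum>j<n. a k j * cnj (a l j))" for k l
    by (simp add: R'_def coeff_sum a_def W_def mult.commute)
  have "lead_indep {..<s} s R' b"
    unfolding lead_indep_def
  proof (intro conjI ballI allI impI)
    fix k l assume k: "k \<in> {..<s}"
    have "degree (R k j * [:W j l:]) \<le> b k" if "j < n" for j
    proof -
      have "degree (R k j) \<le> b k" using R that k by (auto simp: lead_indep_def)
      then show ?thesis by simp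
    qed
    then show "degree (R' k l) \<le> b k"
      unfolding R'_def by (intro degree_sum_le) auto
  next
    fix c k
    assume c: "\<forall>l<s. (\<Sum>k<s. c k * coeff (R' k l) (b k)) = 0" and k: "k \<in> {..<s}"
    define y where "y j = (\<Sum>k<s. c k * a k j)" for j
    \<comment> \<open>The squared norm of the combination \<open>y\<close> of leading vectors equals
      the sum of the assumed relations weighted by \<open>cnj (c l)\<close>; so \<open>y\<close> is
      zero.\<close>
    have "(\<Sum>j<n. y j * cnj (y j)) = (\<Sum>j<n. \<Sum>l<s. cnj (c l) * (y j * cnj (a l j)))"
      by (simp add: y_def sum_distrib_left mult_ac)
    also have "\<dots> = (\<Sum>l<s. cnj (c l) * (\<Sum>j<n. y j * cnj (a l j)))"
      by (subst sum.swap) (simp add: sum_distrib_left)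
    also have "\<dots> = (\<Sum>l<s. cnj (c l) * (\<Sum>k<s. c k * coeff (R' k l) (b k)))"
    proof (rule sum.cong[OF refl], rule arg_cong2[where f = "(*)", OF refl])
      fix l
      show "(\<Sum>j<n. y j * cnj (a l j)) = (\<Sum>k<s. c k * coeff (R' k l) (b k))"
        unfolding coeff y_def sum_distrib_left sum_distrib_right
        by (subst sum.swap) (simp add: mult.assoc)
    qed
    also have "\<dots> = 0" using c by simp
    finally have "complex_of_real (\<Sum>j<n. (cmod (y j))\<^sup>2) = 0"
      by (simp only: of_real_sum complex_norm_square)
    then have "(\<Sum>j<n. (cmod (y j))\<^sup>2) = 0" by (simp only: of_real_eq_0_iff)
    then have "\<forall>j<n. y j = 0" by (simp add: sum_nonneg_eq_0_iff)
    then show "c k = 0" using R k unfolding lead_indep_def y_def a_def by blast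
  qed simp
  then have "c k = 0" if "\<forall>l<s. (\<Sum>k<s. c k * R' k l) = 0" "k < s" for c k
    using that by (intro lead_indep_independent[of "{..<s}" s R' b c k]) auto
  then have "det (mat s s (\<lambda>(k, l). R' k l)) \<noteq> 0"
    unfolding det_eq_0_iff_row_relation by blast
  then show thesis using that[of W] by (simp add: R'_def)
qed

lemma poly_degree_le_altdef:
  fixes p :: "'a :: comm_semiring_1 poly"
  assumes "degree p \<le> d"
  shows "poly p z = (\<Sum>t\<le>d. coeff p t * z ^ t)"
proof -
  have "(\<Sum>t\<le>degree p. coeff p t * z ^ t) = (\<Sum>t\<le>d. coeff p t * z ^ t)"
    using assms by (intro sum.mono_neutral_left) (auto simp: coeff_eq_0)
  then show ?thesis by (simp add: poly_altdef)
qed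

text \<open>\<open>U\<close>, \<open>W\<close> and the evaluation point \<open>z\<close> are chosen
  from the limit \<open>P\<close> alone, so one fixed continuous function of the matrix separates
  \<open>P\<close> from all \<open>Q \<nu>\<close> if \<open>r < s\<close>.\<close>

lemma inner_dim_limit:
  fixes P :: "nat \<Rightarrow> nat \<Rightarrow> complex poly" and Q :: "nat \<Rightarrow> nat \<Rightarrow> nat \<Rightarrow> complex poly"
  assumes QLR: "\<And>\<nu> i j. i < m \<Longrightarrow> j < n \<Longrightarrow> Q \<nu> i j = (\<Sum>t<r. L \<nu> i t * V \<nu> t j)"
    and degQ: "\<And>\<nu> i j. i < m \<Longrightarrow> j < n \<Longrightarrow> degree (Q \<nu> i j) \<le> d"
    and degP: "\<And>i j. i < m \<Longrightarrow> j < n \<Longrightarrow> degree (P i j) \<le> d"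
    and lim: "\<And>i j t. i < m \<Longrightarrow> j < n \<Longrightarrow> t \<le> d \<Longrightarrow> (\<lambda>\<nu>. coeff (Q \<nu> i j) t) \<longlonglongrightarrow> coeff (P i j) t"
    and R: "lead_indep {..<s} n R b"
    and RUP: "\<And>k j. k < s \<Longrightarrow> j < n \<Longrightarrow> R k j = (\<Sum>i<m. U k i * P i j)"
  shows "s \<le> r"
proof (rule ccontr)
  assume "\<not> s \<le> r"
  then have rs: "r < s" by simp
  obtain W where W: "det (mat s s (\<lambda>(k, l). \<Sum>j<n. R k j * [:W j l:])) \<noteq> 0" (is "?p \<noteq> 0")
    using lead_indep_complement[OF R] by blast
  then obtain z where z: "poly ?p z \<noteq> 0" using poly_all_0_iff_0 by blast
  \<comment> \<open>The entries of \<open>U X W\<close> evaluated at \<open>z\<close>.\<close>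
  define G where "G X k l = (\<Sum>j<n. (\<Sum>i<m. poly (U k i) z * poly (X i j) z) * W j l)"
    for X :: "nat \<Rightarrow> nat \<Rightarrow> complex poly" and k l
  have "poly ?p z = det (mat s s (\<lambda>(k, l). G P k l))"
    unfolding poly_det
    by (intro arg_cong[where f = det] cong_mat) (auto simp: poly_sum RUP G_def mult.commute)
  moreover have "det (mat s s (\<lambda>(k, l). G (Q \<nu>) k l)) = 0" for \<nu>
  proof -
    have "G (Q \<nu>) k l = (\<Sum>t<r. (\<Sum>i<m. poly (U k i) z * poly (L \<nu> i t) z)
        * (\<Sum>j<n. poly (V \<nu> t j) z * W j l))" for k l
    proof -
      have "G (Q \<nu>) k l = (\<Sum>j<n. (\<Sum>t<r. (\<Sum>i<m. poly (U k i) z * poly (L \<nu> i t) z)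
          * poly (V \<nu> t j) z) * W j l)"
        unfolding G_def
      proof (rule sum.cong[OF refl], rule arg_cong2[where f = "(*)", OF _ refl])
        fix j assume "j \<in> {..<n}"
        then have "(\<Sum>i<m. poly (U k i) z * poly (Q \<nu> i j) z)
          = (\<Sum>i<m. \<Sum>t<r. poly (U k i) z * poly (L \<nu> i t) z * poly (V \<nu> t j) z)"
          by (intro sum.cong refl) (simp add: QLR poly_sum sum_distrib_left mult.assoc)
        also have "\<dots> = (\<Sum>t<r. (\<Sum>i<m. poly (U k i) z * poly (L \<nu> i t) z) * poly (V \<nu> t j) z)"
          by (subst sum.swap) (simp add: sum_distrib_right)
        finally show "(\<Sum>i<m. poly (U k i) z * poly (Q \<nu> i j) z) = \<dots>" .
      qed
      also have "\<dots> = (\<Sum>t<r. (\<Sum>i<m. poly (U k i) z * poly (L \<nu> i t) z)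
          * (\<Sum>j<n. poly (V \<nu> t j) z * W j l))"
        unfolding sum_distrib_right[of _ _ "W _ _"] sum_distrib_left[of _ _ "{..<n}"]
        by (subst sum.swap) (simp add: mult.assoc)
      finally show ?thesis .
    qed
    then show ?thesis using det_eq_0_of_inner_dim[OF rs] by simp
  qed
  moreover have "(\<lambda>\<nu>. det (mat s s (\<lambda>(k, l). G (Q \<nu>) k l))) \<longlonglongrightarrow> det (mat s s (\<lambda>(k, l). G P k l))"
  proof (rule tendsto_det)
    \<comment> \<open>The common degree bound \<open>d\<close> makes evaluation a sum of fixed
      length, so coefficientwise convergence suffices.\<close>
    have "(\<lambda>\<nu>. poly (Q \<nu> i j) z) \<longlonglongrightarrow> poly (P i j) z" if "i < m" "j < n" for i j
      unfolding poly_degree_le_altdef[OF degQ[OF that]] poly_degree_le_altdef[OF degP[OF that]]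
      by (intro tendsto_sum tendsto_mult tendsto_const lim that) simp
    then show "(\<lambda>\<nu>. G (Q \<nu>) k l) \<longlonglongrightarrow> G P k l" for k l
      unfolding G_def by (intro tendsto_sum tendsto_mult tendsto_const) auto
  qed
  ultimately have "poly ?p z = 0" by (simp add: LIMSEQ_const_iff)
  then show False using z by simp
qed


section \<open>Degree-balanced factorizations\<close>

lemma vdeg_cases:
  obtains "vdeg v = -\<infinity>" | t :: nat where "vdeg v = ereal (real t)"
proof -
  have "vdeg v = -\<infinity> \<or> (\<exists>t::nat. vdeg v = ereal (real t))" by (auto simp: vdeg_def)
  then show thesis using that by blast
qed

lemma vdeg_eqI:
  fixes v :: "complex poly vec"
  assumes "\<And>k. k < dim_vec v \<Longrightarrow> degree (v $ k) \<le> t" "k < dim_vec v" "coeff (v $ k) t \<noteq> 0"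
  shows "vdeg v = ereal (real t)"
proof -
  have "degree (v $ k) = t" using assms le_degree by (intro antisym) auto
  moreover have "v $ k \<noteq> 0" using assms(3) by auto
  ultimately have "Max {degree (v $ k) | k. k < dim_vec v} = t"
    using assms by (intro Max_eqI) auto
  then show ?thesis using assms(2) \<open>v $ k \<noteq> 0\<close> by (auto simp: vdeg_def)
qed

lemma degree_le_vdeg:
  fixes v :: "complex poly vec"
  assumes "vdeg v = ereal (real t)" "k < dim_vec v"
  shows "degree (v $ k) \<le> t"
proof -
  have "t = Max {degree (v $ k) | k. k < dim_vec v}"
    using assms(1) by (auto simp: vdeg_def split: if_splits)
  then show ?thesis using assms(2) by (auto intro!: Max_ge)
qed

text \<open>A zero vector would contribute \<open>-\<infinity>\<close> and, as no
  \<open>vdeg\<close> is \<open>\<infinity>\<close>, make the whole sum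
  \<open>-\<infinity>\<close>.\<close>

lemma vdeg_add_eq_natE:
  assumes "vdeg u + vdeg v = ereal (real d)"
  obtains p q :: nat where "vdeg u = ereal (real p)" "vdeg v = ereal (real q)" "p + q = d"
proof (cases u rule: vdeg_cases)
  case 1
  then show thesis using assms by (cases v rule: vdeg_cases) auto
next
  case (2 p)
  show thesis
  proof (cases v rule: vdeg_cases)
    case 1
    then show thesis using assms \<open>vdeg u = ereal (real p)\<close> by simp
  next
    case (2 q)
    then have "real (p + q) = real d" using assms \<open>vdeg u = ereal (real p)\<close> by simp
    then show thesis using that 2 \<open>vdeg u = ereal (real p)\<close> by (simp only: of_nat_eq_iff)
  qed
qed

lemma index_mult_mat_sum:
  assumes "L \<in> carrier_mat m r" "R \<in> carrier_mat r n" "i < m" "j < n"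
  shows "(L * R) $$ (i, j) = (\<Sum>k<r. L $$ (i, k) * R $$ (k, j))"
  using assms by (auto simp: scalar_prod_def atLeast0LessThan)

lemma A_set_eq_Union: "A_set m n d r = (\<Union>a\<in>{0..r * d}. A_set_a m n d r a)"
proof
  show "A_set m n d r \<subseteq> (\<Union>a\<in>{0..r * d}. A_set_a m n d r a)"
  proof
    fix Q assume "Q \<in> A_set m n d r"
    then obtain L R where Q: "Q = L * R" and L: "L \<in> carrier_mat m r" and R: "R \<in> carrier_mat r n"
      and deg: "\<forall>i<r. vdeg (col L i) + vdeg (row R i) = ereal (real d)"
      unfolding A_set_def by blast
    have "\<exists>q\<le>d. vdeg (row R i) = ereal (real q)" if "i < r" for i
    proof -
      have "vdeg (col L i) + vdeg (row R i) = ereal (real d)" using deg that by blast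
      then obtain p q where "vdeg (row R i) = ereal (real q)" "p + q = d"
        by (rule vdeg_add_eq_natE)
      then show ?thesis by auto
    qed
    then obtain q where q: "\<And>i. i < r \<Longrightarrow> q i \<le> d \<and> vdeg (row R i) = ereal (real (q i))"
      by metis
    have "(\<Sum>i<r. vdeg (row R i)) = ereal (real (\<Sum>i<r. q i))" using q by simp
    then have "Q \<in> A_set_a m n d r (\<Sum>i<r. q i)"
      using Q L R deg unfolding A_set_a_def by blast
    moreover have "(\<Sum>i<r. q i) \<le> r * d" using sum_bounded_above[of "{..<r}" q d] q by simp
    ultimately show "Q \<in> (\<Union>a\<in>{0..r * d}. A_set_a m n d r a)" by auto
  qed
  show "(\<Union>a\<in>{0..r * d}. A_set_a m n d r a) \<subseteq> A_set m n d r"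
    unfolding A_set_def A_set_a_def by blast
qed

lemma A_set_entries:
  assumes "Q \<in> A_set m n d r"
  obtains L R where "Q \<in> carrier_mat m n"
    "\<And>i j. i < m \<Longrightarrow> j < n \<Longrightarrow> Q $$ (i, j) = (\<Sum>k<r. L i k * R k j)"
    "\<And>i j. i < m \<Longrightarrow> j < n \<Longrightarrow> degree (Q $$ (i, j)) \<le> d"
proof -
  obtain L R where Q: "Q = L * R" and L: "L \<in> carrier_mat m r" and R: "R \<in> carrier_mat r n"
    and deg: "\<forall>i<r. vdeg (col L i) + vdeg (row R i) = ereal (real d)"
    using assms unfolding A_set_def by blast
  have entry: "Q $$ (i, j) = (\<Sum>k<r. L $$ (i, k) * R $$ (k, j))" if "i < m" "j < n" for i j
    unfolding Q by (rule index_mult_mat_sum[OF L R that])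
  have "degree (Q $$ (i, j)) \<le> d" if ij: "i < m" "j < n" for i j
    unfolding entry[OF ij]
  proof (intro degree_sum_le)
    fix k assume "k \<in> {..<r}"
    then have k: "k < r" by simp
    then have "vdeg (col L k) + vdeg (row R k) = ereal (real d)" using deg by blast
    then obtain p q where pq: "vdeg (col L k) = ereal (real p)" "vdeg (row R k) = ereal (real q)"
      "p + q = d"
      by (rule vdeg_add_eq_natE)
    have "degree (col L k $ i) \<le> p" "degree (row R k $ j) \<le> q"
      using degree_le_vdeg[OF pq(1), of i] degree_le_vdeg[OF pq(2), of j] L R ij by auto
    then have "degree (L $$ (i, k)) \<le> p" "degree (R $$ (k, j)) \<le> q"
      using L R ij k by auto
    then show "degree (L $$ (i, k) * R $$ (k, j)) \<le> d"
      using degree_mult_le[of "L $$ (i, k)" "R $$ (k, j)"] pq(3) by linarith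
  qed simp
  moreover have "Q \<in> carrier_mat m n" unfolding Q using L R by simp
  ultimately show thesis using that[of "\<lambda>i k. L $$ (i, k)" "\<lambda>k j. R $$ (k, j)"] entry by blast
qed

section \<open>Limits of products keep the degree and rank bounds\<close>

lemma coeff_diff_le_pm_dist:
  assumes "P \<in> carrier_mat m n" "i < m" "j < n" "t \<le> d"
  shows "cmod (coeff (P $$ (i, j)) t - coeff (Q $$ (i, j)) t) \<le> pm_dist d P Q"
proof -
  let ?f = "\<lambda>t i j. (cmod (coeff (P $$ (i, j)) t - coeff (Q $$ (i, j)) t))\<^sup>2"
  have "?f t i j \<le> (\<Sum>j<n. ?f t i j)"
    using assms by (intro member_le_sum) auto
  also have "\<dots> \<le> (\<Sum>i<m. \<Sum>j<n. ?f t i j)"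
    using assms by (intro member_le_sum[of i "{..<m}" "\<lambda>i. \<Sum>j<n. ?f t i j"] sum_nonneg) auto
  also have "\<dots> \<le> (\<Sum>t\<le>d. \<Sum>i<m. \<Sum>j<n. ?f t i j)"
    using assms by (intro member_le_sum[of t "{..d}" "\<lambda>t. \<Sum>i<m. \<Sum>j<n. ?f t i j"] sum_nonneg) auto
  finally have "?f t i j \<le> (pm_dist d P Q)\<^sup>2"
    using assms by (simp add: pm_dist_def sum_nonneg)
  then show ?thesis
    by (rule power2_le_imp_le) (auto simp: pm_dist_def intro!: sum_nonneg)
qed

text \<open>Row reduction of the limit \<open>P\<close> gives an inner dimension \<open>s\<close>
  with \<open>normal_rank P \<le> s\<close>; \<open>inner_dim_limit\<close> along an approximating
  sequence gives \<open>s \<le> r\<close>.\<close>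

lemma pm_closure_subset_polymat_dr:
  assumes X: "X \<subseteq> A_set m n d r"
  shows "pm_closure m n d X \<subseteq> polymat_dr m n d r"
proof
  fix P assume P: "P \<in> pm_closure m n d X"
  then have carr: "P \<in> carrier_mat m n" and degP: "\<forall>i<m. \<forall>j<n. degree (P $$ (i, j)) \<le> d"
    and close: "\<forall>e>0. \<exists>Q\<in>X. pm_dist d P Q < e"
    by (auto simp: pm_closure_def)
  have "\<exists>Q\<in>A_set m n d r. pm_dist d P Q < 1 / real (Suc \<nu>)" for \<nu>
  proof -
    have "1 / real (Suc \<nu>) > 0" by simp
    then show ?thesis using close X by blast
  qed
  then obtain Q where Q: "\<And>\<nu>. Q \<nu> \<in> A_set m n d r" "\<And>\<nu>. pm_dist d P (Q \<nu>) < 1 / real (Suc \<nu>)"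
    by metis
  have "\<exists>L V. (\<forall>i<m. \<forall>j<n. Q \<nu> $$ (i, j) = (\<Sum>k<r. L i k * V k j))" for \<nu>
    by (rule A_set_entries[OF Q(1)[of \<nu>]]) blast
  then obtain L V where LV: "\<And>\<nu> i j. i < m \<Longrightarrow> j < n \<Longrightarrow> Q \<nu> $$ (i, j) = (\<Sum>k<r. L \<nu> i k * V \<nu> k j)"
    by metis
  have degQ: "degree (Q \<nu> $$ (i, j)) \<le> d" if "i < m" "j < n" for \<nu> i j
    by (rule A_set_entries[OF Q(1)[of \<nu>]]) (use that in blast)
  obtain s L' R U b where R: "lead_indep {..<s} n R b"
    and PLR: "\<And>i j. i < m \<Longrightarrow> j < n \<Longrightarrow> P $$ (i, j) = (\<Sum>k<s. L' i k * R k j)"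
    and RUP: "\<And>k j. k < s \<Longrightarrow> j < n \<Longrightarrow> R k j = (\<Sum>i<m. U k i * P $$ (i, j))"
    by (rule row_reduction[of n m "\<lambda>i j. P $$ (i, j)"]) blast
  have "normal_rank P \<le> s" by (rule normal_rank_le_inner_dim[OF carr PLR])
  also have "s \<le> r"
  proof (rule inner_dim_limit[where Q = "\<lambda>\<nu> i j. Q \<nu> $$ (i, j)" and P = "\<lambda>i j. P $$ (i, j)",
        OF LV degQ _ _ R RUP])
    fix i j t assume ijt: "i < m" "j < n" "t \<le> d"
    have "(\<lambda>\<nu>. coeff (P $$ (i, j)) t - coeff (Q \<nu> $$ (i, j)) t) \<longlonglongrightarrow> 0"
    proof (rule Lim_null_comparison)
      show "\<forall>\<^sub>F \<nu> in sequentially. norm (coeff (P $$ (i, j)) t - coeff (Q \<nu> $$ (i, j)) t) \<le> 1 / real (Suc \<nu>)"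
        using coeff_diff_le_pm_dist[OF carr ijt] Q(2)
        by (intro always_eventually allI less_imp_le) (rule le_less_trans)
      show "(\<lambda>\<nu>. 1 / real (Suc \<nu>)) \<longlonglongrightarrow> 0" by (rule LIMSEQ_Suc[OF lim_1_over_n])
    qed
    then have "(\<lambda>\<nu>. coeff (P $$ (i, j)) t - (coeff (P $$ (i, j)) t - coeff (Q \<nu> $$ (i, j)) t))
        \<longlonglongrightarrow> coeff (P $$ (i, j)) t - 0"
      by (intro tendsto_diff tendsto_const)
    then show "(\<lambda>\<nu>. coeff (Q \<nu> $$ (i, j)) t) \<longlonglongrightarrow> coeff (P $$ (i, j)) t" by simp
  qed (use degP in auto)
  finally show "P \<in> polymat_dr m n d r" using carr degP by (simp add: polymat_dr_def)
qed


section \<open>Approximation by degree-balanced products\<close>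

lemma lead_indep_nonzero:
  assumes R: "lead_indep J n R b" and k: "k \<in> J"
  shows "\<exists>j<n. coeff (R k j) (b k) \<noteq> 0"
proof (rule ccontr)
  assume "\<not> ?thesis"
  then have "(\<Sum>l\<in>J. of_bool (l = k) * coeff (R l j) (b l)) = 0" if "j < n" for j
    using that by (intro sum.neutral) auto
  then have "of_bool (k = k) = (0 :: 'a)"
    using R k unfolding lead_indep_def by (elim conjE allE[of _ "\<lambda>l. of_bool (l = k)"]) blast
  then show False by simp
qed

text \<open>Rows of \<open>R\<close> whose companion column of \<open>L\<close> vanishes may have degree above \<open>d\<close>; they do not
  contribute to the product and are replaced by a unit vector.\<close>

lemma degree_balanced_factorization:
  assumes P: "P \<in> polymat_dr m n d r" and n: "n > 0"
  obtains L R b where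
    "\<And>i j. i < m \<Longrightarrow> j < n \<Longrightarrow> P $$ (i, j) = (\<Sum>k<r. L i k * R k j)"
    "\<And>k. b k \<le> d"
    "\<And>i k. i < m \<Longrightarrow> degree (L i k) \<le> d - b k"
    "\<And>k j. j < n \<Longrightarrow> degree (R k j) \<le> b k"
    "\<And>k. \<exists>j<n. coeff (R k j) (b k) \<noteq> 0"
proof -
  have carr: "P \<in> carrier_mat m n" and degP: "\<And>i j. i < m \<Longrightarrow> j < n \<Longrightarrow> degree (P $$ (i, j)) \<le> d"
    and rk: "normal_rank P \<le> r"
    using P by (auto simp: polymat_dr_def)
  obtain s L R U b where R: "lead_indep {..<s} n R b"
    and PLR: "\<And>i j. i < m \<Longrightarrow> j < n \<Longrightarrow> P $$ (i, j) = (\<Sum>k<s. L i k * R k j)"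
    and RUP: "\<And>k j. k < s \<Longrightarrow> j < n \<Longrightarrow> R k j = (\<Sum>i<m. U k i * P $$ (i, j))"
    by (rule row_reduction[of n m "\<lambda>i j. P $$ (i, j)"]) blast
  have sr: "s \<le> r" using lead_indep_le_normal_rank[OF carr R RUP] rk by linarith
  have deg: "degree (L i k) + b k \<le> d" if "i < m" "k < s" "L i k \<noteq> 0" for i k
  \<comment> \<open>Row \<open>i\<close> of \<open>L\<close> combines the rows of \<open>R\<close>
    into a row of \<open>P\<close>, whose coefficients vanish from \<open>Suc d\<close> on.\<close>
  proof -
    have "coeff (\<Sum>k<s. L i k * R k j) t = 0" if "j < n" "Suc d \<le> t" for j t
    proof -
      have "degree (P $$ (i, j)) < t" using degP[OF \<open>i < m\<close> \<open>j < n\<close>] that by linarith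
      then show ?thesis using PLR[OF \<open>i < m\<close> \<open>j < n\<close>] by (simp add: coeff_eq_0)
    qed
    then show ?thesis
      using predictable_degree[OF R, of "Suc d" "L i" k] that by simp
  qed
  \<comment> \<open>Indices with \<open>s \<le> k < r\<close> count as not good too: they pad the
    inner dimension to exactly \<open>r\<close> with zero columns and unit rows.\<close>
  define good where "good k \<longleftrightarrow> k < s \<and> (\<exists>i<m. L i k \<noteq> 0)" for k
  define L' where "L' i k = (if good k then L i k else 0)" for i k
  define R' where "R' k j = (if good k then R k j else if j = 0 then 1 else 0)" for k j
  define b' where "b' k = (if good k then b k else 0)" for k
  show thesis
  proof (rule that[of L' R' b'])
    fix i j assume ij: "i < m" "j < n"
    have "(\<Sum>k<s. L i k * R k j) = (\<Sum>k<r. L' i k * R' k j)"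
      using sr ij by (intro sum.mono_neutral_cong_left) (auto simp: L'_def R'_def good_def)
    then show "P $$ (i, j) = (\<Sum>k<r. L' i k * R' k j)" using PLR ij by simp
  next
    fix k show "b' k \<le> d" using deg by (force simp: b'_def good_def)
  next
    fix i k assume "i < m"
    then show "degree (L' i k) \<le> d - b' k"
      using deg[of i k] by (cases "L i k = 0") (auto simp: L'_def b'_def good_def)
  next
    fix k j assume "j < n"
    then show "degree (R' k j) \<le> b' k"
      using R by (auto simp: R'_def b'_def good_def lead_indep_def)
  next
    fix k show "\<exists>j<n. coeff (R' k j) (b' k) \<noteq> 0"
    proof (cases "good k")
      case True
      then show ?thesis using lead_indep_nonzero[OF R, of k] by (simp add: R'_def b'_def good_def)
    next
      case False
      then show ?thesis using n by (intro exI[of _ 0]) (simp add: R'_def b'_def)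
    qed
  qed
qed

lemma pm_dist_smult:
  assumes P: "P \<in> carrier_mat m n" and "\<epsilon> \<ge> 0"
    and Q: "\<And>i j. i < m \<Longrightarrow> j < n \<Longrightarrow> Q $$ (i, j) = P $$ (i, j) + Polynomial.smult (complex_of_real \<epsilon>) (X i j)"
  shows "pm_dist d P Q = \<epsilon> * sqrt (\<Sum>t\<le>d. \<Sum>i<m. \<Sum>j<n. (cmod (coeff (X i j) t))\<^sup>2)"
proof -
  have "(\<Sum>t\<le>d. \<Sum>i<m. \<Sum>j<n. (cmod (coeff (P $$ (i, j)) t - coeff (Q $$ (i, j)) t))\<^sup>2)
    = \<epsilon>\<^sup>2 * (\<Sum>t\<le>d. \<Sum>i<m. \<Sum>j<n. (cmod (coeff (X i j) t))\<^sup>2)"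
    unfolding sum_distrib_left
    by (intro sum.cong refl) (simp add: Q norm_mult power_mult_distrib)
  then show ?thesis using P \<open>\<epsilon> \<ge> 0\<close> by (simp add: pm_dist_def real_sqrt_mult)
qed

lemma polymat_dr_in_pm_closure:
  assumes P: "P \<in> polymat_dr m n d r" and m: "m > 0" and n: "n > 0"
  shows "\<exists>a\<le>r * d. P \<in> pm_closure m n d (A_set_a m n d r a)"
proof -
  have carr: "P \<in> carrier_mat m n" and degP: "\<forall>i<m. \<forall>j<n. degree (P $$ (i, j)) \<le> d"
    using P by (auto simp: polymat_dr_def)
  obtain L R b where PLR: "\<And>i j. i < m \<Longrightarrow> j < n \<Longrightarrow> P $$ (i, j) = (\<Sum>k<r. L i k * R k j)"
    and b: "\<And>k. b k \<le> d"
    and degL: "\<And>i k. i < m \<Longrightarrow> degree (L i k) \<le> d - b k"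
    and degR: "\<And>k j. j < n \<Longrightarrow> degree (R k j) \<le> b k"
    and leadR: "\<And>k. \<exists>j<n. coeff (R k j) (b k) \<noteq> 0"
    by (rule degree_balanced_factorization[OF P n]) blast
  \<comment> \<open>Column \<open>k\<close> of \<open>L\<close> already has degree exactly
    \<open>d - b k\<close>.\<close>
  define full where "full k \<longleftrightarrow> (\<exists>i<m. coeff (L i k) (d - b k) \<noteq> 0)" for k
  \<comment> \<open>In a deficient column the coefficient at \<open>d - b k\<close> is zero, so the
    added monomial cannot cancel for any \<open>\<epsilon> > 0\<close>.\<close>
  define E :: "nat \<Rightarrow> nat \<Rightarrow> complex poly"
    where "E i k = (if i = 0 \<and> \<not> full k then monom 1 (d - b k) else 0)" for i k
  define X where "X i j = (\<Sum>k<r. E i k * R k j)" for i j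
  define C where "C = sqrt (\<Sum>t\<le>d. \<Sum>i<m. \<Sum>j<n. (cmod (coeff (X i j) t))\<^sup>2)"
  define Rm where "Rm = mat r n (\<lambda>(k, j). R k j)"
  define Lm where "Lm \<epsilon> = mat m r (\<lambda>(i, k). L i k + Polynomial.smult (complex_of_real \<epsilon>) (E i k))" for \<epsilon>
  have carr': "Lm \<epsilon> \<in> carrier_mat m r" "Rm \<in> carrier_mat r n" for \<epsilon>
    by (simp_all add: Lm_def Rm_def)
  have row: "vdeg (row Rm k) = ereal (real (b k))" if k: "k < r" for k
  proof -
    obtain j where "j < n" "coeff (R k j) (b k) \<noteq> 0" using leadR by blast
    then show ?thesis
      using degR k by (intro vdeg_eqI[of _ _ j]) (auto simp: Rm_def)
  qed
  have col: "vdeg (col (Lm \<epsilon>) k) = ereal (real (d - b k))" if k: "k < r" and \<epsilon>: "\<epsilon> > 0" for k \<epsilon>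
  proof -
    obtain i where i: "i < m" "coeff (L i k + Polynomial.smult (complex_of_real \<epsilon>) (E i k)) (d - b k) \<noteq> 0"
    proof (cases "full k")
      case True
      then show thesis using that by (auto simp: full_def E_def)
    next
      case False
      then have "coeff (L 0 k) (d - b k) = 0" using m by (auto simp: full_def)
      then show thesis using that[of 0] False m \<epsilon> by (simp add: E_def)
    qed
    have "degree (L i k + Polynomial.smult (complex_of_real \<epsilon>) (E i k)) \<le> d - b k" if "i < m" for i
      using degL[OF that] degree_monom_le[of "1 :: complex" "d - b k"]
      by (intro degree_add_le order.trans[OF degree_smult_le]) (auto simp: E_def)
    then show ?thesis
      using i k by (intro vdeg_eqI[of _ _ i]) (auto simp: Lm_def)
  qed
  have mem: "Lm \<epsilon> * Rm \<in> A_set_a m n d r (\<Sum>k<r. b k)" if "\<epsilon> > 0" for \<epsilon>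
  proof -
    have "\<forall>k<r. vdeg (col (Lm \<epsilon>) k) + vdeg (row Rm k) = ereal (real d)"
      using row col that b by (simp flip: of_nat_add)
    moreover have "(\<Sum>k<r. vdeg (row Rm k)) = ereal (real (\<Sum>k<r. b k))"
      using row by simp
    ultimately show ?thesis using carr' unfolding A_set_a_def by blast
  qed
  have dist: "pm_dist d P (Lm \<epsilon> * Rm) = \<epsilon> * C" if "\<epsilon> > 0" for \<epsilon>
    unfolding C_def
  proof (rule pm_dist_smult[OF carr])
    fix i j assume ij: "i < m" "j < n"
    have "(Lm \<epsilon> * Rm) $$ (i, j) = (\<Sum>k<r. (L i k + Polynomial.smult (complex_of_real \<epsilon>) (E i k)) * R k j)"
      unfolding index_mult_mat_sum[OF carr' ij] using ij
      by (intro sum.cong refl) (simp add: Lm_def Rm_def)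
    also have "\<dots> = P $$ (i, j) + Polynomial.smult (complex_of_real \<epsilon>) (X i j)"
      using ij by (simp add: PLR X_def distrib_right sum.distrib poly_eq_iff coeff_sum sum_distrib_left)
    finally show "(Lm \<epsilon> * Rm) $$ (i, j) = P $$ (i, j) + Polynomial.smult (complex_of_real \<epsilon>) (X i j)" .
  qed (use that in simp)
  have "C \<ge> 0" by (simp add: C_def sum_nonneg)
  have "\<exists>Q\<in>A_set_a m n d r (\<Sum>k<r. b k). pm_dist d P Q < e" if "e > 0" for e
  proof -
    \<comment> \<open>The distance is \<open>\<epsilon> * C\<close>; dividing by
      \<open>C + 1\<close> covers the case \<open>C = 0\<close>.\<close>
    have "e / (C + 1) > 0" "e / (C + 1) * C < e"
      using that \<open>C \<ge> 0\<close> by (simp_all add: divide_simps algebra_simps)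
    then show ?thesis using mem dist by metis
  qed
  then have "P \<in> pm_closure m n d (A_set_a m n d r (\<Sum>k<r. b k))"
    using carr degP by (simp add: pm_closure_def)
  moreover have "(\<Sum>k<r. b k) \<le> r * d" using sum_bounded_above[of "{..<r}" b d] b by simp
  ultimately show ?thesis by blast
qed

theorem theorem4p3:
  fixes m n r d :: nat
  assumes "m \<ge> 2" and "n \<ge> 2" and "d \<ge> 1" and "0 < r" and "r < min m n"
  shows "A_set m n d r = (\<Union>a\<in>{0..r*d}. A_set_a m n d r a)
    \<and> polymat_dr m n d r = (\<Union>a\<in>{0..r*d}. pm_closure m n d (A_set_a m n d r a))
    \<and> (\<forall>P\<in>polymat_dr m n d r. \<exists>a. a \<le> r*d \<and> P \<in> pm_closure m n d (A_set_a m n d r a))"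
proof -
  have approx: "\<exists>a\<le>r * d. P \<in> pm_closure m n d (A_set_a m n d r a)"
    if "P \<in> polymat_dr m n d r" for P
    using polymat_dr_in_pm_closure[OF that] assms by simp
  have "A_set_a m n d r a \<subseteq> A_set m n d r" for a
    unfolding A_set_def A_set_a_def by blast
  then have "pm_closure m n d (A_set_a m n d r a) \<subseteq> polymat_dr m n d r" for a
    by (rule pm_closure_subset_polymat_dr)
  \<comment> \<open>\<open>approx\<close> yields (iii) and one inclusion of (ii); the closure bound
    yields the other.\<close>
  then show ?thesis using A_set_eq_Union approx by fastforce
qed

end
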